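(* Let $D$ be an integral domain which is not a field, with quotient field $K$, let $\overline{K}$ be a fixed algebraic closure of $K$, and let $\overline{D}$ be the integral closure of $D$ in $\overline{K}$. Assume that $D$ is integrally closed and let $\Omega$ be a finite subset of $\overline{D}$. Then the ring $\mathrm{Int}_K(\Omega,\overline{D})$ is Prüfer if and only if $D$ is Prüfer.
   Context: For a subset $\Omega\subseteq\overline{K}$, $\mathrm{Int}_K(\Omega,\overline{D})=\{f\in K[X] : f(\Omega)\subset\overline{D}\}$, the ring of polynomials in $K[X]$ which map every element of $\Omega$ into $\overline{D}$; it is a subring of $K[X]$.
   Formalization: The finite set Ω is assumed nonempty: for Ω empty the ring is K[X], which is always Prüfer, while an integrally closed D such as k[x,y] need not be Prüfer. *)

theory Defs
  imports "HOL-Computational_Algebra.Computational_Algebra"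
begin

definition is_subring :: "'a::comm_ring_1 set \<Rightarrow> bool" where
  "is_subring R \<longleftrightarrow> 1 \<in> R \<and> (\<forall>x\<in>R. \<forall>y\<in>R. x - y \<in> R \<and> x * y \<in> R)"

text \<open>The quotient field of a subring \<open>R\<close> of a field, formed inside that field.\<close>

definition quotient_field :: "'a::field set \<Rightarrow> 'a set" where
  "quotient_field R = {a / b |a b. a \<in> R \<and> b \<in> R \<and> b \<noteq> 0}"

text \<open>\<open>A[X]\<close> as a subset of the polynomials over the ambient ring.\<close>

definition polys_over :: "'a::comm_ring_1 set \<Rightarrow> 'a poly set" where
  "polys_over A = {p. \<forall>i. coeff p i \<in> A}"

definition algebraic_over :: "'a::field set \<Rightarrow> 'a \<Rightarrow> bool" where
  "algebraic_over K x \<longleftrightarrow> (\<exists>p \<in> polys_over K. p \<noteq> 0 \<and> poly p x = 0)"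

definition integral_over :: "'a::comm_ring_1 set \<Rightarrow> 'a \<Rightarrow> bool" where
  "integral_over R x \<longleftrightarrow> (\<exists>p \<in> polys_over R. lead_coeff p = 1 \<and> poly p x = 0)"

text \<open>The integral closure of \<open>R\<close> in the whole ambient ring.\<close>

definition integral_closure :: "'a::comm_ring_1 set \<Rightarrow> 'a set" where
  "integral_closure R = {x. integral_over R x}"

definition integrally_closed :: "'a::field set \<Rightarrow> bool" where
  "integrally_closed R \<longleftrightarrow> (\<forall>x \<in> quotient_field R. integral_over R x \<longrightarrow> x \<in> R)"


definition is_submodule :: "'a::comm_ring_1 set \<Rightarrow> 'a set \<Rightarrow> bool" where
  "is_submodule R M \<longleftrightarrow>
     0 \<in> M \<and> (\<forall>x\<in>M. \<forall>y\<in>M. x + y \<in> M) \<and> (\<forall>r\<in>R. \<forall>x\<in>M. r * x \<in> M)"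

text \<open>
  For \<open>S \<subseteq> R\<close>, \<open>is_submodule R hull S\<close> is the ideal of \<open>R\<close> generated by \<open>S\<close>.
\<close>

definition fractional_ideal :: "'a::field set \<Rightarrow> 'a set \<Rightarrow> bool" where
  "fractional_ideal R I \<longleftrightarrow>
     is_submodule R I \<and> I \<subseteq> quotient_field R \<and> (\<exists>d\<in>R. d \<noteq> 0 \<and> (\<forall>x\<in>I. d * x \<in> R))"

definition ideal_prod :: "'a::comm_ring_1 set \<Rightarrow> 'a set \<Rightarrow> 'a set \<Rightarrow> 'a set" where
  "ideal_prod R I J = is_submodule R hull {x * y |x y. x \<in> I \<and> y \<in> J}"

definition invertible_ideal :: "'a::field set \<Rightarrow> 'a set \<Rightarrow> bool" where
  "invertible_ideal R I \<longleftrightarrow>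
     fractional_ideal R I \<and> (\<exists>J. fractional_ideal R J \<and> ideal_prod R I J = R)"

text \<open>
  A subring \<open>R\<close> of a field is a Pruefer domain if every nonzero finitely generated
  ideal of \<open>R\<close> is invertible. The ambient field may be larger than the quotient field
  of \<open>R\<close>; fractional ideals are taken inside the latter.
\<close>

definition pruefer_domain :: "'a::field set \<Rightarrow> bool" where
  "pruefer_domain R \<longleftrightarrow>
     is_subring R \<and>
     (\<forall>S. finite S \<and> S \<subseteq> R \<and> is_submodule R hull S \<noteq> {0} \<longrightarrow>
        invertible_ideal R (is_submodule R hull S))"

text \<open>\<open>Int\<^sub>K(\<Omega>, B)\<close>, for \<open>K\<close>, \<open>\<Omega>\<close> and \<open>B\<close> contained in a common field.\<close>

definition int_valued :: "'a::field set \<Rightarrow> 'a set \<Rightarrow> 'a set \<Rightarrow> 'a poly set" where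
  "int_valued K \<Omega> B = {f \<in> polys_over K. poly f ` \<Omega> \<subseteq> B}"

end

theory Submission
  imports Defs "Jordan_Normal_Form.Char_Poly"
begin

text \<open>
  A domain \<open>R\<close> is Pruefer exactly when every ratio \<open>t\<close> of its elements splits: some \<open>x \<in> R\<close> has
  \<open>x t \<in> R\<close> and \<open>(1 - x) / t \<in> R\<close>. This says that the ideals with two generators are invertible, and
  a dual family \<open>q\<^sub>i\<close> with \<open>\<Sum>\<^sub>i q\<^sub>i d\<^sub>i = 1\<close> and all \<open>q\<^sub>i d\<^sub>j \<in> R\<close> can be built from it for any number of
  generators \<open>d\<^sub>i\<close> (\<open>pruefer_imp_ratio_splits\<close>, \<open>ratio_splits_imp_pruefer\<close>). Both implications of the
  theorem transport splitting elements; \<open>O\<close> denotes the integral closure of \<open>D\<close>.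

  If the ring of integer-valued polynomials is Pruefer, a ratio \<open>t \<in> K\<close> splits by a polynomial, and the
  value \<open>u\<close> of this polynomial at a point of \<open>\<Omega>\<close> splits \<open>t\<close> over \<open>O\<close>. All conjugates \<open>r\<close> of \<open>u\<close> over \<open>K\<close>
  split \<open>t\<close> as well, and so does \<open>1 - \<Prod>(1 - r)\<close>. This element is in \<open>K\<close>, since up to a constant
  the product is the value at \<open>1\<close> of the minimal polynomial of \<open>u\<close>. As \<open>D\<close> is integrally closed,
  \<open>t\<close> splits over \<open>D\<close> (\<open>ratio_splits_descends\<close>).

  If \<open>D\<close> is Pruefer, every ratio \<open>t\<close> algebraic over \<open>K\<close> splits over \<open>O\<close> by an element of \<open>K[t]\<close>: a dual
  family of the coefficients of an equation for \<open>t\<close> combines its Horner values to a splitting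
  element (\<open>ratio_splits_integral_closure\<close>). Let \<open>f, g \<in> K[X]\<close> be coprime. A splitting element of
  \<open>f / g\<close> amounts to polynomials \<open>y, z\<close> over \<open>K\<close> with \<open>f z + g y = 1\<close> such that \<open>f y\<close>, \<open>f z\<close>, \<open>g y\<close>, \<open>g z\<close> are
  integral on \<open>\<Omega>\<close>. At one point \<open>w\<close> they are found by splitting \<open>f(w) / g(w)\<close>. Interpolation
  extends this to \<open>\<Omega>\<close>; it suffices to treat points that are not conjugate, because integrality of
  a value of a polynomial over \<open>K\<close> passes to conjugates. The relation then holds up to
  a polynomial vanishing on \<open>\<Omega>\<close>, and a Bezout relation in \<open>K[X]\<close> removes this error
  (\<open>global_integral_bezout\<close>).
\<close>

section \<open>Subrings, quotient fields and polynomials over a subring\<close>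

lemma subring_diff: "is_subring R \<Longrightarrow> x \<in> R \<Longrightarrow> y \<in> R \<Longrightarrow> x - y \<in> R"
  and subring_mult: "is_subring R \<Longrightarrow> x \<in> R \<Longrightarrow> y \<in> R \<Longrightarrow> x * y \<in> R"
  and subring_1: "is_subring R \<Longrightarrow> 1 \<in> R"
  by (auto simp: is_subring_def)

lemma subring_0: "is_subring R \<Longrightarrow> 0 \<in> R"
  using subring_diff[of R 1 1] subring_1 by auto

lemma subring_uminus: "is_subring R \<Longrightarrow> x \<in> R \<Longrightarrow> - x \<in> R"
  using subring_diff[of R 0 x] subring_0 by auto

lemma subring_add: "is_subring R \<Longrightarrow> x \<in> R \<Longrightarrow> y \<in> R \<Longrightarrow> x + y \<in> R"
  using subring_diff[of R x "- y"] subring_uminus by auto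

lemma subring_sum: "is_subring R \<Longrightarrow> (\<And>i. i \<in> I \<Longrightarrow> f i \<in> R) \<Longrightarrow> sum f I \<in> R"
  by (induction I rule: infinite_finite_induct) (auto simp: subring_0 subring_add)

lemma subring_prod: "is_subring R \<Longrightarrow> (\<And>i. i \<in> I \<Longrightarrow> f i \<in> R) \<Longrightarrow> prod f I \<in> R"
  by (induction I rule: infinite_finite_induct) (auto simp: subring_1 subring_mult)

lemma subring_power: "is_subring R \<Longrightarrow> x \<in> R \<Longrightarrow> x ^ n \<in> R"
  by (induction n) (auto simp: subring_1 subring_mult)

lemmas subring_closed = subring_1 subring_0 subring_uminus subring_add subring_diff
  subring_mult subring_power

lemma subset_quotient_field: "is_subring R \<Longrightarrow> R \<subseteq> quotient_field R"
  unfolding quotient_field_def using subring_1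
  by (metis (mono_tags, lifting) div_by_1 mem_Collect_eq subsetI zero_neq_one)

lemma quotient_field_divide:
  "is_subring R \<Longrightarrow> a \<in> R \<Longrightarrow> b \<in> R \<Longrightarrow> a / b \<in> quotient_field R"
  using subset_quotient_field[of R] subring_0[of R]
  by (cases "b = 0") (force, auto simp: quotient_field_def)

lemma quotient_field_subring:
  fixes R :: "'a::field set"
  assumes R: "is_subring R"
  shows "is_subring (quotient_field R)"
  unfolding is_subring_def
proof (intro conjI ballI)
  show "1 \<in> quotient_field R"
    using subset_quotient_field[OF R] subring_1[OF R] by blast
next
  fix x y assume "x \<in> quotient_field R" "y \<in> quotient_field R"
  then obtain a b c d where xy: "x = a / b" "y = c / d"
    and abcd: "a \<in> R" "b \<in> R" "c \<in> R" "d \<in> R" "b \<noteq> 0" "d \<noteq> 0"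
    unfolding quotient_field_def by blast
  have "x - y = (a * d - c * b) / (b * d)" "x * y = (a * c) / (b * d)"
    using xy abcd by (auto simp: field_simps)
  with abcd R show "x - y \<in> quotient_field R" "x * y \<in> quotient_field R"
    by (metis quotient_field_divide subring_diff subring_mult)+
qed

lemma quotient_field_inverse: "is_subring R \<Longrightarrow> x \<in> quotient_field R \<Longrightarrow> inverse x \<in> quotient_field R"
  using quotient_field_divide[of R] by (force simp: quotient_field_def)

lemma polys_over_subring:
  assumes A: "is_subring A"
  shows "is_subring (polys_over A)"
  unfolding is_subring_def polys_over_def
  using A by (auto simp: coeff_mult subring_closed subring_sum)

lemma polys_over_mono: "A \<subseteq> B \<Longrightarrow> polys_over A \<subseteq> polys_over B"
  by (auto simp: polys_over_def)

lemma coeff_polys_over: "p \<in> polys_over A \<Longrightarrow> coeff p i \<in> A"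
  by (simp add: polys_over_def)

lemma pCons_polys_over_iff: "pCons a p \<in> polys_over A \<longleftrightarrow> a \<in> A \<and> p \<in> polys_over A"
  by (auto simp: polys_over_def coeff_pCons split: nat.splits)

lemma polys_over_const: "is_subring A \<Longrightarrow> a \<in> A \<Longrightarrow> [:a:] \<in> polys_over A"
  using subring_0[OF polys_over_subring] by (simp add: pCons_polys_over_iff)

lemma monom_polys_over: "is_subring A \<Longrightarrow> a \<in> A \<Longrightarrow> monom a n \<in> polys_over A"
  by (simp add: polys_over_def subring_0)

lemma smult_polys_over: "is_subring A \<Longrightarrow> a \<in> A \<Longrightarrow> p \<in> polys_over A \<Longrightarrow> Polynomial.smult a p \<in> polys_over A"
  by (simp add: polys_over_def subring_mult)

lemma poly_in_subring: "is_subring A \<Longrightarrow> p \<in> polys_over A \<Longrightarrow> x \<in> A \<Longrightarrow> poly p x \<in> A"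
  by (auto simp: poly_altdef polys_over_def intro!: subring_sum subring_closed)

lemma pcompose_polys_over:
  assumes A: "is_subring A" and "p \<in> polys_over A" and q: "q \<in> polys_over A"
  shows "pcompose p q \<in> polys_over A"
  using assms(2)
  by (induction p)
     (auto simp: pcompose_pCons pCons_polys_over_iff A q polys_over_const
        intro!: subring_closed[OF polys_over_subring[OF A]])

section \<open>Integral elements\<close>

lemma is_submodule_hull: "is_submodule R (is_submodule R hull S)"
  by (rule hull_in) (auto simp: is_submodule_def)

lemma submodule_closed:
  assumes "is_submodule R M"
  shows submodule_0: "0 \<in> M"
    and submodule_add: "x \<in> M \<Longrightarrow> y \<in> M \<Longrightarrow> x + y \<in> M"
    and submodule_smult: "r \<in> R \<Longrightarrow> x \<in> M \<Longrightarrow> r * x \<in> M"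
  using assms by (auto simp: is_submodule_def)

lemma submodule_sum: "is_submodule R M \<Longrightarrow> (\<And>i. i \<in> I \<Longrightarrow> f i \<in> M) \<Longrightarrow> sum f I \<in> M"
  by (induction I rule: infinite_finite_induct) (auto simp: submodule_closed)

text \<open>
  For \<open>N = R\<close> the combinations form the module generated by \<open>V\<close>, and for an ideal \<open>N = J\<close>
  they form the product of that module with \<open>J\<close>.
\<close>

lemma submodule_combinations:
  assumes N: "is_submodule R N"
  shows "is_submodule R {\<Sum>v\<in>V. c v * v |c. \<forall>v\<in>V. c v \<in> N}" (is "is_submodule R ?M")
  unfolding is_submodule_def
proof (intro conjI ballI)
  show "0 \<in> ?M"
    by (rule CollectI, rule exI[of _ "\<lambda>_. 0"]) (use N in \<open>auto simp: submodule_closed\<close>)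
next
  fix x y assume "x \<in> ?M" "y \<in> ?M"
  then obtain c d where cd: "x = (\<Sum>v\<in>V. c v * v)" "y = (\<Sum>v\<in>V. d v * v)"
    "\<forall>v\<in>V. c v \<in> N" "\<forall>v\<in>V. d v \<in> N" by blast
  show "x + y \<in> ?M"
    by (rule CollectI, rule exI[of _ "\<lambda>v. c v + d v"])
       (use cd N in \<open>auto simp: submodule_closed algebra_simps sum.distrib\<close>)
next
  fix r x assume "r \<in> R" "x \<in> ?M"
  then obtain c where c: "r \<in> R" "x = (\<Sum>v\<in>V. c v * v)" "\<forall>v\<in>V. c v \<in> N" by blast
  show "r * x \<in> ?M"
    by (rule CollectI, rule exI[of _ "\<lambda>v. r * c v"])
       (use c N in \<open>auto simp: submodule_closed algebra_simps sum_distrib_left\<close>)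
qed

lemma subring_is_submodule: "is_subring R \<Longrightarrow> is_submodule R R"
  by (auto simp: is_submodule_def subring_closed)

lemma hull_finite_combination:
  assumes R: "is_subring R" and V: "finite V" and x: "x \<in> is_submodule R hull V"
  obtains c where "\<And>v. v \<in> V \<Longrightarrow> c v \<in> R" "x = (\<Sum>v\<in>V. c v * v)"
proof -
  have "is_submodule R hull V \<subseteq> {\<Sum>v\<in>V. c v * v |c. \<forall>v\<in>V. c v \<in> R}" (is "_ \<subseteq> ?M")
  proof (rule hull_minimal)
    show "V \<subseteq> ?M"
    proof
      fix w assume w: "w \<in> V"
      have "w = (\<Sum>v\<in>V. of_bool (v = w) * v)"
        using V w by (simp add: of_bool_def if_distrib[of "\<lambda>x. x * _"] cong: if_cong)
      moreover have "\<forall>v\<in>V. of_bool (v = w) \<in> R"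
        using R by (auto simp: subring_closed of_bool_def)
      ultimately show "w \<in> ?M"
        by (intro CollectI exI[of _ "\<lambda>v. of_bool (v = w)"] conjI)
    qed
  qed (rule submodule_combinations[OF subring_is_submodule[OF R]])
  with x that show ?thesis by blast
qed

lemma hull_stable_under_mult:
  assumes "\<And>v. v \<in> V \<Longrightarrow> z * v \<in> is_submodule R hull V" and "x \<in> is_submodule R hull V"
  shows "z * x \<in> is_submodule R hull V"
proof -
  have "is_submodule R hull V \<subseteq> {x. z * x \<in> is_submodule R hull V}"
    by (rule hull_minimal)
       (use assms(1) is_submodule_hull[of R V] in
         \<open>auto simp: is_submodule_def distrib_left mult.left_commute\<close>)
  with assms(2) show ?thesis by blast
qed

lemma det_in_subring:
  assumes "is_subring A" and M: "M \<in> carrier_mat n n"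
    and "\<And>i j. i < n \<Longrightarrow> j < n \<Longrightarrow> M $$ (i, j) \<in> A"
  shows "det M \<in> A"
  unfolding det_def'[OF M]
proof (intro subring_sum subring_mult subring_prod assms)
  show "signof p \<in> A" for p :: "nat \<Rightarrow> nat"
    by (cases p rule: sign_cases) (simp_all add: assms(1) subring_closed)
qed (auto simp: permutes_in_image)

text \<open>
  The determinant trick: in terms of the generators, multiplication by \<open>z\<close> is given by a
  matrix with entries in \<open>R\<close>, and \<open>z\<close> is one of its eigenvalues because the
  vector of generators is a nonzero eigenvector.
\<close>

lemma integral_if_stabilizes_fg_module:
  fixes z :: "'a::field"
  assumes R: "is_subring R" and V: "finite V" "1 \<in> V"
    and stable: "\<And>v. v \<in> V \<Longrightarrow> z * v \<in> is_submodule R hull V"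
  shows "z \<in> integral_closure R"
proof -
  obtain vs where vs: "set vs = V" "distinct vs"
    using finite_distinct_list[OF V(1)] by blast
  define n where "n = length vs"
  have "\<exists>c. (\<forall>w\<in>V. c w \<in> R) \<and> z * v = (\<Sum>w\<in>V. c w * w)" if "v \<in> V" for v
    by (rule hull_finite_combination[OF R V(1) stable[OF that]]) blast
  then have "\<exists>c. \<forall>v\<in>V. (\<forall>w\<in>V. c v w \<in> R) \<and> z * v = (\<Sum>w\<in>V. c v w * w)"
    by (intro bchoice) blast
  then obtain c where c: "\<And>v w. v \<in> V \<Longrightarrow> w \<in> V \<Longrightarrow> c v w \<in> R"
    "\<And>v. v \<in> V \<Longrightarrow> z * v = (\<Sum>w\<in>V. c v w * w)" by blast
  define M where "M = mat n n (\<lambda>(i, j). c (vs ! i) (vs ! j))"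
  define u where "u = vec n (\<lambda>i. vs ! i)"
  have M: "M \<in> carrier_mat n n" by (simp add: M_def)
  have nth_V: "vs ! i \<in> V" if "i < n" for i
    using that vs n_def by auto
  have "M *\<^sub>v u = z \<cdot>\<^sub>v u"
  proof (rule eq_vecI)
    fix i assume "i < dim_vec (z \<cdot>\<^sub>v u)"
    then have i: "i < n" by (simp add: u_def)
    have "(M *\<^sub>v u) $ i = (\<Sum>j<n. c (vs ! i) (vs ! j) * vs ! j)"
      using i by (simp add: M_def u_def scalar_prod_def lessThan_atLeast0)
    also have "\<dots> = (\<Sum>w\<in>V. c (vs ! i) w * w)"
      using vs n_def by (intro sum.reindex_bij_betw bij_betw_nth) auto
    also have "\<dots> = z * vs ! i"
      using c(2)[OF nth_V[OF i]] by simp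
    finally show "(M *\<^sub>v u) $ i = (z \<cdot>\<^sub>v u) $ i"
      using i by (simp add: u_def)
  qed (simp_all add: M_def u_def)
  moreover have "u \<noteq> 0\<^sub>v n"
  proof
    assume u: "u = 0\<^sub>v n"
    obtain i where "i < n" "vs ! i = 1"
      using V(2) vs n_def by (metis in_set_conv_nth)
    moreover have "u $ i = 0" using u \<open>i < n\<close> by simp
    ultimately show False by (simp add: u_def)
  qed
  ultimately have "eigenvalue M z"
    unfolding eigenvalue_def eigenvector_def using M by (intro exI[of _ u]) (auto simp: u_def)
  then have "poly (char_poly M) z = 0"
    using eigenvalue_root_char_poly[OF M] by simp
  moreover have "lead_coeff (char_poly M) = 1"
    using degree_monic_char_poly[OF M] by simp
  moreover have "char_poly M \<in> polys_over R"
    unfolding char_poly_defs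
    by (rule det_in_subring[OF polys_over_subring[OF R], of _ n])
       (use R c(1) nth_V in \<open>auto simp: M_def pCons_polys_over_iff subring_closed
          subring_closed[OF polys_over_subring[OF R]]\<close>)
  ultimately show ?thesis
    by (auto simp: integral_closure_def integral_over_def)
qed

lemma integral_closureI:
  "p \<in> polys_over R \<Longrightarrow> lead_coeff p = 1 \<Longrightarrow> poly p x = 0 \<Longrightarrow> x \<in> integral_closure R"
  by (auto simp: integral_closure_def integral_over_def)

lemma integral_closureE:
  assumes "x \<in> integral_closure R"
  obtains p where "p \<in> polys_over R" "lead_coeff p = 1" "poly p x = 0"
  using assms by (auto simp: integral_closure_def integral_over_def)

lemma subset_integral_closure:
  assumes R: "is_subring R" shows "R \<subseteq> integral_closure R"
proof
  fix a assume "a \<in> R"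
  with R show "a \<in> integral_closure R"
    by (intro integral_closureI[of "[:- a, 1:]"])
       (auto simp: pCons_polys_over_iff subring_closed subring_0[OF polys_over_subring[OF R]])
qed

text \<open>
  The monomials \<open>x\<^sup>i y\<^sup>j\<close> below the degrees of monic equations for \<open>x\<close> and \<open>y\<close> generate
  a module that both \<open>x\<close> and \<open>y\<close>, hence also their difference and product, stabilize.
\<close>

lemma integral_closure_subring:
  fixes R :: "'a::field set"
  assumes R: "is_subring R"
  shows "is_subring (integral_closure R)"
proof -
  have "x - y \<in> integral_closure R \<and> x * y \<in> integral_closure R"
    if xy: "x \<in> integral_closure R" "y \<in> integral_closure R" for x y
  proof -
    obtain p where p: "p \<in> polys_over R" "lead_coeff p = 1" "poly p x = 0"
      using xy(1) by (rule integral_closureE)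
    obtain q where q: "q \<in> polys_over R" "lead_coeff q = 1" "poly q y = 0"
      using xy(2) by (rule integral_closureE)
    define V where "V = (\<lambda>(i, j). x ^ i * y ^ j) ` ({..<degree p} \<times> {..<degree q})"
    let ?M = "is_submodule R hull V"
    have monomial: "x ^ i * y ^ j \<in> ?M" if "i < degree p" "j < degree q" for i j
      using that by (intro hull_inc) (auto simp: V_def)
    note M = is_submodule_hull[of R V]
    have power_degree: "r ^ degree f = (\<Sum>i<degree f. - coeff f i * r ^ i)"
      if "lead_coeff f = 1" "poly f r = 0" for f and r :: 'a
      using that by (simp add: poly_altdef sum_negf lessThan_Suc_atMost[symmetric] add_eq_0_iff)
    have top_x: "x ^ i * y ^ j \<in> ?M" if "i = degree p" "j < degree q" for i j
    proof -
      have "x ^ i * y ^ j = (\<Sum>k<degree p. - coeff p k * (x ^ k * y ^ j))"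
        unfolding that(1) power_degree[OF p(2,3)] by (simp add: sum_distrib_left sum_distrib_right mult_ac)
      also have "\<dots> \<in> ?M"
        using that R coeff_polys_over[OF p(1)]
        by (intro submodule_sum[OF M] submodule_smult[OF M] monomial) (auto simp: subring_uminus)
      finally show ?thesis .
    qed
    have "x * v \<in> ?M" if v: "v \<in> V" for v
    proof -
      obtain i j where ij: "v = x ^ i * y ^ j" "i < degree p" "j < degree q"
        using v by (auto simp: V_def)
      have top: "x * v = x ^ Suc i * y ^ j" using ij(1) by (simp add: mult_ac)
      show ?thesis unfolding top
        using monomial[of "Suc i" j] top_x[of "Suc i" j] ij(2,3)
        by (cases "Suc i = degree p") (auto simp del: power_Suc)
    qed
    then have x_stable: "x * m \<in> ?M" if "m \<in> ?M" for m
      using hull_stable_under_mult that by blast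
    have top_y: "x ^ i * y ^ j \<in> ?M" if "j = degree q" "i < degree p" for i j
    proof -
      have "x ^ i * y ^ j = (\<Sum>k<degree q. - coeff q k * (x ^ i * y ^ k))"
        unfolding that(1) power_degree[OF q(2,3)] by (simp add: sum_distrib_left mult_ac)
      also have "\<dots> \<in> ?M"
        using that R coeff_polys_over[OF q(1)]
        by (intro submodule_sum[OF M] submodule_smult[OF M] monomial) (auto simp: subring_uminus)
      finally show ?thesis .
    qed
    have "y * v \<in> ?M" if v: "v \<in> V" for v
    proof -
      obtain i j where ij: "v = x ^ i * y ^ j" "i < degree p" "j < degree q"
        using v by (auto simp: V_def)
      have top: "y * v = x ^ i * y ^ Suc j" using ij(1) by (simp add: mult_ac)
      show ?thesis unfolding top
        using monomial[of i "Suc j"] top_y[of "Suc j" i] ij(2,3)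
        by (cases "Suc j = degree q") (auto simp del: power_Suc)
    qed
    then have y_stable: "y * m \<in> ?M" if "m \<in> ?M" for m
      using hull_stable_under_mult that by blast
    have V: "finite V" by (simp add: V_def)
    have deg_pos: "degree f > 0" if "lead_coeff f = 1" "poly f r = 0" for f and r :: 'a
      using power_degree[OF that] by (cases "degree f") auto
    have "1 \<in> V"
      using deg_pos[OF p(2,3)] deg_pos[OF q(2,3)] 
      unfolding V_def by (intro image_eqI[of _ _ "(0, 0)"]) auto
    note integral = integral_if_stabilizes_fg_module[OF R V this]
    have "(x - y) * v \<in> ?M" "x * y * v \<in> ?M" if "v \<in> V" for v
    proof -
      have v: "v \<in> ?M" using that by (rule hull_inc)
      have "x * v + (- 1) * (y * v) \<in> ?M"
        by (intro submodule_add[OF M] submodule_smult[OF M] x_stable y_stable v)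
           (simp add: R subring_closed)
      then show "(x - y) * v \<in> ?M" by (simp add: algebra_simps)
      show "x * y * v \<in> ?M" using x_stable[OF y_stable[OF v]] by (simp add: mult.assoc)
    qed
    then show ?thesis using integral by blast
  qed
  then show ?thesis
    using subset_integral_closure[OF R] subring_1[OF R] unfolding is_subring_def by blast
qed

section \<open>Pruefer domains through ratios\<close>

text \<open>
  Geometrically, \<open>Spec R\<close> is covered by the open set \<open>x \<noteq> 0\<close>, on which \<open>t\<close> is regular,
  and the open set \<open>1 - x \<noteq> 0\<close>, on which \<open>1 / t\<close> is regular; \<open>t = a / b\<close> has such an
  \<open>x\<close> exactly when the ideal \<open>(a, b)\<close> is invertible. Because \<open>c / 0 = 0\<close>, the ratio
  \<open>t = 0\<close> splits with \<open>x = 0\<close>.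
\<close>

definition ratio_splits :: "'a::field set \<Rightarrow> 'a \<Rightarrow> bool" where
  "ratio_splits R t \<longleftrightarrow> (\<exists>x\<in>R. x * t \<in> R \<and> (1 - x) / t \<in> R)"

lemma ratio_splits_0: "is_subring R \<Longrightarrow> ratio_splits R 0"
  unfolding ratio_splits_def by (intro bexI[of _ 0]) (auto simp: subring_0)

lemma hull_subset_subring:
  assumes "is_subring R" "S \<subseteq> R" shows "is_submodule R hull S \<subseteq> R"
  using assms by (intro hull_minimal subring_is_submodule)

text \<open>
  An element of \<open>I J\<close> is a combination of the generators of \<open>I\<close> with coefficients in \<open>J\<close>; for the
  inverse \<open>J\<close> of \<open>I\<close> this applies to \<open>1\<close>.
\<close>

lemma invertible_hull_imp_dual_family:
  fixes R :: "'a::field set"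
  assumes R: "is_subring R" and S: "finite S" "S \<subseteq> R"
    and inv: "invertible_ideal R (is_submodule R hull S)"
  obtains q where "\<And>s s'. s \<in> S \<Longrightarrow> s' \<in> S \<Longrightarrow> q s * s' \<in> R" "(\<Sum>s\<in>S. q s * s) = 1"
proof -
  obtain J where J: "fractional_ideal R J" "ideal_prod R (is_submodule R hull S) J = R"
    using inv unfolding invertible_ideal_def by blast
  have J': "is_submodule R J" using J(1) by (simp add: fractional_ideal_def)
  let ?M = "{\<Sum>s\<in>S. q s * s |q. \<forall>s\<in>S. q s \<in> J}"
  have "ideal_prod R (is_submodule R hull S) J \<subseteq> ?M"
    unfolding ideal_prod_def
  proof (rule hull_minimal)
    show "{x * y |x y. x \<in> is_submodule R hull S \<and> y \<in> J} \<subseteq> ?M"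
    proof clarify
      fix x y assume x: "x \<in> is_submodule R hull S" and y: "y \<in> J"
      obtain c where c: "\<And>s. s \<in> S \<Longrightarrow> c s \<in> R" "x = (\<Sum>s\<in>S. c s * s)"
        using hull_finite_combination[OF R S(1) x] by blast
      show "\<exists>q. x * y = (\<Sum>s\<in>S. q s * s) \<and> (\<forall>s\<in>S. q s \<in> J)"
        by (rule exI[of _ "\<lambda>s. c s * y"])
           (use c y submodule_smult[OF J'] in \<open>auto simp: sum_distrib_right mult.assoc mult.left_commute mult.commute[of y]\<close>)
    qed
  qed (rule submodule_combinations[OF J'])
  with J(2) subring_1[OF R] obtain q where q: "\<forall>s\<in>S. q s \<in> J" "(\<Sum>s\<in>S. q s * s) = 1"
    by force
  have "q s * s' \<in> R" if "s \<in> S" "s' \<in> S" for s s'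
  proof -
    have "s' * q s \<in> ideal_prod R (is_submodule R hull S) J"
      unfolding ideal_prod_def using q(1) that hull_inc[of s' S]
      by (intro hull_inc) blast
    then show ?thesis using J(2) by (simp add: mult.commute)
  qed
  with q(2) that show ?thesis by blast
qed

lemma pruefer_imp_ratio_splits:
  fixes R :: "'a::field set"
  assumes P: "pruefer_domain R" and t: "t \<in> quotient_field R"
  shows "ratio_splits R t"
proof -
  have R: "is_subring R" using P by (simp add: pruefer_domain_def)
  obtain a b where t': "t = a / b" and ab: "a \<in> R" "b \<in> R" "b \<noteq> 0"
    using t by (auto simp: quotient_field_def)
  have "b \<in> is_submodule R hull {a, b}" by (simp add: hull_inc)
  with ab have "is_submodule R hull {a, b} \<noteq> {0}" "{a, b} \<subseteq> R" by auto
  with P[unfolded pruefer_domain_def, THEN conjunct2, rule_format, of "{a, b}"]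
  have "invertible_ideal R (is_submodule R hull {a, b})" by simp
  then obtain q where q: "\<And>s s'. s \<in> {a, b} \<Longrightarrow> s' \<in> {a, b} \<Longrightarrow> q s * s' \<in> R"
    "(\<Sum>s\<in>{a, b}. q s * s) = 1"
    using invertible_hull_imp_dual_family[OF R, of "{a, b}"] ab by blast
  consider "a = b" | "a = 0" | "a \<noteq> b" "a \<noteq> 0" by blast
  then show ?thesis
  proof cases
    case 1
    then show ?thesis using t' ab R
      by (auto simp: ratio_splits_def subring_closed intro!: bexI[of _ 1])
  next
    case 2
    then show ?thesis using t' R by (simp add: ratio_splits_0)
  next
    case 3
    then have "q a * a + q b * b = 1" using q(2) by simp
    then have "q b * b * t = q b * a" "(1 - q b * b) / t = q a * b"
      using 3 t' ab by (auto simp: field_simps)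
    moreover have "q b * b \<in> R" "q b * a \<in> R" "q a * b \<in> R" using q(1) by auto
    ultimately show ?thesis unfolding ratio_splits_def by metis
  qed
qed

text \<open>
  Each ratio of a new element to the old ones distributes the old partition of unity between the
  two: if \<open>y\<^sub>i\<close> splits \<open>c / d\<^sub>i\<close>, the family \<open>q\<^sub>i y\<^sub>i\<close> extends by \<open>(1 - \<Sum>\<^sub>i q\<^sub>i y\<^sub>i d\<^sub>i) / c\<close>.
\<close>

lemma ratio_splits_imp_dual_family_nonzero:
  fixes R :: "'a::field set"
  assumes R: "is_subring R" and splits: "\<And>t. t \<in> quotient_field R \<Longrightarrow> ratio_splits R t"
    and "finite I" "I \<noteq> {}" "\<And>i. i \<in> I \<Longrightarrow> d i \<in> quotient_field R" "\<And>i. i \<in> I \<Longrightarrow> d i \<noteq> 0"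
  shows "\<exists>q. (\<forall>i\<in>I. \<forall>j\<in>I. q i * d j \<in> R) \<and> (\<Sum>i\<in>I. q i * d i) = 1"
  using assms(3-)
proof (induction rule: finite_ne_induct)
  case (singleton k)
  then show ?case by (intro exI[of _ "\<lambda>_. inverse (d k)"]) (simp add: R subring_1)
next
  case (insert k I)
  then obtain q where q: "\<And>i j. i \<in> I \<Longrightarrow> j \<in> I \<Longrightarrow> q i * d j \<in> R" "(\<Sum>i\<in>I. q i * d i) = 1"
    by (metis insert_iff)
  define c where "c = d k"
  have c: "c \<noteq> 0" "c \<in> quotient_field R" using insert.prems by (auto simp: c_def)
  have "\<exists>y\<in>R. y * (c / d i) \<in> R \<and> (1 - y) * (d i / c) \<in> R" if "i \<in> I" for i
  proof -
    have "c / d i \<in> quotient_field R"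
      unfolding divide_inverse using c that insert.prems R
      by (auto intro!: subring_mult[OF quotient_field_subring[OF R]] quotient_field_inverse)
    with splits show ?thesis by (fastforce simp: ratio_splits_def)
  qed
  then have "\<exists>y. \<forall>i\<in>I. y i \<in> R \<and> y i * (c / d i) \<in> R \<and> (1 - y i) * (d i / c) \<in> R"
    by (intro bchoice) blast
  then obtain y where y: "\<And>i. i \<in> I \<Longrightarrow> y i \<in> R" "\<And>i. i \<in> I \<Longrightarrow> y i * (c / d i) \<in> R"
    "\<And>i. i \<in> I \<Longrightarrow> (1 - y i) * (d i / c) \<in> R" by blast
  define s where "s = (\<Sum>i\<in>I. q i * d i * y i)"
  define q' where "q' i = (if i = k then (1 - s) / c else q i * y i)" for i
  have s: "s \<in> R" unfolding s_def by (intro subring_sum subring_mult R q y)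
  have "1 - s = (\<Sum>i\<in>I. q i * d i * (1 - y i))"
    using q(2) by (simp add: s_def sum_subtractf algebra_simps)
  then have q'_k: "q' k * z = (\<Sum>i\<in>I. (q i * z) * ((1 - y i) * (d i / c)))" for z
    by (simp add: q'_def divide_inverse sum_distrib_left mult_ac)
  have q'_I: "q' i * z = q i * y i * z" if "i \<in> I" for i z
    using that insert.hyps by (auto simp: q'_def)
  have "q' i * d j \<in> R" if i: "i \<in> insert k I" and j: "j \<in> insert k I" for i j
  proof -
    consider "i \<in> I" "j \<in> I" | "i \<in> I" "j = k" | "i = k" "j \<in> I" | "i = k" "j = k"
      using i j by blast
    then show ?thesis
    proof cases
      case 1
      then have "q' i * d j = (q i * d j) * y i" by (simp add: q'_I)
      also have "\<dots> \<in> R" using 1 by (intro subring_mult R q y)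
      finally show ?thesis .
    next
      case 2
      then have "q' i * d j = (q i * d i) * (y i * (c / d i))"
        using insert.prems by (simp add: q'_I c_def)
      also have "\<dots> \<in> R" using 2 by (intro subring_mult R q y)
      finally show ?thesis .
    next
      case 3
      show ?thesis unfolding 3(1) q'_k using 3(2) by (intro subring_sum subring_mult R q y)
    next
      case 4
      then show ?thesis using c s by (simp add: q'_def R subring_closed flip: c_def)
    qed
  qed
  moreover have "(\<Sum>i\<in>insert k I. q' i * d i) = 1"
  proof -
    have "(\<Sum>i\<in>I. q' i * d i) = s"
      unfolding s_def by (intro sum.cong) (simp_all add: q'_I)
    moreover have "q' k * d k = 1 - s" using c by (simp add: q'_def c_def)
    ultimately show ?thesis using insert.hyps by simp
  qed
  ultimately show ?case by blast
qed

lemma ratio_splits_imp_dual_family: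
  fixes R :: "'a::field set"
  assumes R: "is_subring R" and splits: "\<And>t. t \<in> quotient_field R \<Longrightarrow> ratio_splits R t"
    and I: "finite I" "k \<in> I" "d k \<noteq> 0" and d: "\<And>i. i \<in> I \<Longrightarrow> d i \<in> quotient_field R"
  obtains q where "\<And>i j. i \<in> I \<Longrightarrow> j \<in> I \<Longrightarrow> q i * d j \<in> R" "(\<Sum>i\<in>I. q i * d i) = 1"
proof -
  let ?I = "{i \<in> I. d i \<noteq> 0}"
  have "\<exists>q. (\<forall>i\<in>?I. \<forall>j\<in>?I. q i * d j \<in> R) \<and> (\<Sum>i\<in>?I. q i * d i) = 1"
    by (rule ratio_splits_imp_dual_family_nonzero[OF R splits]) (use I d in auto)
  then obtain q where q: "\<forall>i\<in>?I. \<forall>j\<in>?I. q i * d j \<in> R" "(\<Sum>i\<in>?I. q i * d i) = 1" by blast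
  define q' where "q' i = (if d i = 0 then 0 else q i)" for i
  have "q' i * d j \<in> R" if "i \<in> I" "j \<in> I" for i j
    using that q(1) subring_0[OF R] by (cases "d j = 0") (auto simp: q'_def)
  moreover have "(\<Sum>i\<in>I. q' i * d i) = (\<Sum>i\<in>?I. q i * d i)"
    using I(1) by (intro sum.mono_neutral_cong_right) (auto simp: q'_def)
  ultimately show ?thesis using q(2) that by metis
qed

text \<open>
  The inverse of the ideal generated by \<open>S\<close> is \<open>{y. y S \<subseteq> R}\<close>: a dual family of \<open>S\<close> lies in it and
  exhibits \<open>1\<close> as an element of the product.
\<close>

lemma ratio_splits_imp_pruefer:
  fixes R :: "'a::field set"
  assumes R: "is_subring R" and splits: "\<And>t. t \<in> quotient_field R \<Longrightarrow> ratio_splits R t"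
  shows "pruefer_domain R"
  unfolding pruefer_domain_def
proof (intro conjI R allI impI, elim conjE)
  fix S assume S: "finite S" "S \<subseteq> R" and nz: "is_submodule R hull S \<noteq> {0}"
  let ?I = "is_submodule R hull S"
  have "is_submodule R {0}" by (auto simp: is_submodule_def)
  then have "\<exists>s\<in>S. s \<noteq> 0"
    using hull_minimal[of S "{0}" "is_submodule R"] nz submodule_0[OF is_submodule_hull[of R S]] by blast
  then obtain k where k: "k \<in> S" "k \<noteq> 0" by blast
  obtain q where q: "\<And>i j. i \<in> S \<Longrightarrow> j \<in> S \<Longrightarrow> q i * j \<in> R" "(\<Sum>i\<in>S. q i * i) = 1"
    by (rule ratio_splits_imp_dual_family[OF R splits S(1) k(1), of "\<lambda>i. i"])
       (use k S subset_quotient_field[OF R] in auto)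
  define J where "J = {y. \<forall>s\<in>S. y * s \<in> R}"
  have IR: "?I \<subseteq> R" by (rule hull_subset_subring[OF R S(2)])
  have J_mod: "is_submodule R J"
    using R by (auto simp: J_def is_submodule_def subring_closed distrib_right mult.assoc)
  have "J \<subseteq> quotient_field R"
  proof
    fix y assume "y \<in> J"
    then have "y = (y * k) / k" "y * k \<in> R" using k by (auto simp: J_def)
    then show "y \<in> quotient_field R" using quotient_field_divide[OF R] k S(2) by (metis subsetD)
  qed
  then have J: "fractional_ideal R J"
    unfolding fractional_ideal_def using J_mod k S(2)
    by (auto simp: J_def mult.commute intro!: bexI[of _ k])
  have I: "fractional_ideal R ?I"
    unfolding fractional_ideal_def
    using is_submodule_hull[of R S] IR subset_quotient_field[OF R] subring_1[OF R]
    by (auto intro!: bexI[of _ 1])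
  have "ideal_prod R ?I J = R"
  proof
    show "ideal_prod R ?I J \<subseteq> R"
      unfolding ideal_prod_def
    proof (intro hull_minimal subring_is_submodule R)
      show "{x * y |x y. x \<in> ?I \<and> y \<in> J} \<subseteq> R"
      proof clarify
        fix x y assume x: "x \<in> ?I" and y: "y \<in> J"
        have "?I \<subseteq> {x. x * y \<in> R}"
          using y R by (intro hull_minimal)
            (auto simp: J_def is_submodule_def subring_closed distrib_right mult.assoc mult.commute[of y])
        with x show "x * y \<in> R" by blast
      qed
    qed
  next
    have M: "is_submodule R (ideal_prod R ?I J)"
      unfolding ideal_prod_def by (rule is_submodule_hull)
    have "(\<Sum>i\<in>S. i * q i) \<in> ideal_prod R ?I J"
      unfolding ideal_prod_def using q(1)
      by (intro submodule_sum[OF is_submodule_hull] hull_inc CollectI)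
         (auto simp: J_def hull_inc intro!: exI)
    then have "1 \<in> ideal_prod R ?I J" using q(2) by (simp add: mult.commute)
    then show "R \<subseteq> ideal_prod R ?I J" using submodule_smult[OF M] by fastforce
  qed
  with I J show "invertible_ideal R ?I" by (auto simp: invertible_ideal_def)
qed

section \<open>Pruefer domains and integral closure\<close>

lemma poly_cutoff_shift:
  fixes p :: "'a::comm_ring_1 poly"
  shows "p = poly_cutoff i p + monom 1 i * poly_shift i p"
  by (rule poly_eqI) (auto simp: coeff_poly_cutoff coeff_poly_shift coeff_monom_mult)

text \<open>
  Multiplication by \<open>s = poly (poly_shift i p) t\<close> preserves the module generated by
  the powers \<open>t\<^sup>j\<close> with \<open>j \<le> degree p\<close>: for \<open>j < i\<close> the degree of \<open>t\<^sup>j s\<close> in \<open>t\<close> stays below that of \<open>p\<close>,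
  and for \<open>j \<ge> i\<close> the equation \<open>p(t) = 0\<close> replaces \<open>t\<^sup>i s\<close>, the part of \<open>p(t)\<close> of degree at least \<open>i\<close>,
  by the negative of the part of lower degree.
\<close>

lemma integral_poly_shift:
  fixes t :: "'a::field"
  assumes R: "is_subring R" and p: "p \<in> polys_over R" "poly p t = 0"
  shows "poly (poly_shift i p) t \<in> integral_closure R"
proof -
  define n where "n = Suc (degree p)"
  define V where "V = (\<lambda>j. t ^ j) ` {..<n}"
  let ?M = "is_submodule R hull V"
  note M = is_submodule_hull[of R V]
  have poly_M: "poly r t \<in> ?M" if "r \<in> polys_over R" "degree r < n" for r
    unfolding poly_altdef using that
    by (intro submodule_sum[OF M] submodule_smult[OF M] hull_inc)
       (auto simp: V_def coeff_polys_over)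
  have shift: "poly_shift i p \<in> polys_over R" and cutoff: "poly_cutoff i p \<in> polys_over R"
    using p(1) subring_0[OF R] by (auto simp: polys_over_def coeff_poly_shift coeff_poly_cutoff)
  note RX = polys_over_subring[OF R]
  show ?thesis
  proof (rule integral_if_stabilizes_fg_module[OF R])
    show "finite V" "1 \<in> V" by (auto simp: V_def n_def intro!: image_eqI[of _ _ 0])
  next
    fix v assume "v \<in> V"
    then obtain j where j: "v = t ^ j" "j < n" by (auto simp: V_def)
    show "poly (poly_shift i p) t * v \<in> ?M"
    proof (cases "j < i")
      case True
      let ?r = "poly_shift i p * monom 1 j"
      have "degree ?r \<le> n - 1"
      proof (rule degree_le, intro allI impI)
        fix k assume "n - 1 < k"
        then show "coeff ?r k = 0"
          using True by (auto simp: mult.commute[of "poly_shift i p"] coeff_monom_mult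
            coeff_poly_shift n_def intro!: coeff_eq_0)
      qed
      then have "poly ?r t \<in> ?M"
        using shift by (intro poly_M subring_mult[OF RX] monom_polys_over) (auto simp: R subring_1 n_def)
      then show ?thesis by (simp add: j poly_monom)
    next
      case False
      let ?r = "- (monom 1 (j - i) * poly_cutoff i p)"
      have "0 = poly (poly_cutoff i p) t + t ^ i * poly (poly_shift i p) t"
        using p(2) by (subst (asm) poly_cutoff_shift[of p i]) (simp add: poly_monom)
      then have "t ^ i * poly (poly_shift i p) t = - poly (poly_cutoff i p) t"
        by (simp add: eq_neg_iff_add_eq_0 add.commute)
      moreover have "poly (poly_shift i p) t * v = t ^ (j - i) * (t ^ i * poly (poly_shift i p) t)"
        using False by (simp add: j mult.commute flip: power_add mult.assoc)
      ultimately have "poly (poly_shift i p) t * v = poly ?r t"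
        by (simp add: poly_monom)
      also have "\<dots> \<in> ?M"
      proof (rule poly_M)
        have "degree (monom 1 (j - i) * poly_cutoff i p) \<le> j"
          by (rule degree_le) (use False in \<open>auto simp: coeff_monom_mult coeff_poly_cutoff\<close>)
        then show "degree ?r < n" using j(2) by simp
        show "?r \<in> polys_over R"
          by (intro subring_uminus[OF RX] subring_mult[OF RX] monom_polys_over cutoff)
             (auto simp: R subring_1)
      qed
      finally show ?thesis .
    qed
  qed
qed

text \<open>
  Multiplying an equation \<open>\<Sum>\<^sub>i d\<^sub>i t\<^sup>i = 0\<close> by a dual family \<open>q\<close> of its coefficients gives equations
  over \<open>D\<close>, and the \<open>i\<close>-th one has \<open>i\<close>-th coefficient \<open>q\<^sub>i d\<^sub>i\<close>. The Horner values
  \<open>s\<^sub>i = d\<^sub>i + t s\<^bsub>i + 1\<^esub>\<close> turn \<open>\<Sum>\<^sub>i q\<^sub>i d\<^sub>i = 1\<close> into \<open>x - t \<Sum>\<^sub>i q\<^sub>i s\<^bsub>i + 1\<^esub> = 1\<close>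
  with \<open>x = \<Sum>\<^sub>i q\<^sub>i s\<^sub>i\<close>. The splitting element lies in \<open>K[t]\<close>, which is what allows it to be
  interpolated by polynomials over \<open>K\<close>.
\<close>

lemma ratio_splits_integral_closure:
  fixes D K :: "'a::field set"
  assumes P: "pruefer_domain D" and K: "K = quotient_field D" and t: "algebraic_over K t"
  obtains g where "g \<in> polys_over K" "poly g t \<in> integral_closure D"
    "poly g t * t \<in> integral_closure D" "(1 - poly g t) / t \<in> integral_closure D"
proof -
  have D: "is_subring D" using P by (simp add: pruefer_domain_def)
  let ?O = "integral_closure D"
  note O = integral_closure_subring[OF D] and KK = quotient_field_subring[OF D, folded K]
  obtain p where p: "p \<in> polys_over K" "p \<noteq> 0" "poly p t = 0"
    using t by (auto simp: algebraic_over_def)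
  define I where "I = {..degree p}"
  obtain q where q: "\<And>i j. i \<in> I \<Longrightarrow> j \<in> I \<Longrightarrow> q i * coeff p j \<in> D" "(\<Sum>i\<in>I. q i * coeff p i) = 1"
    by (rule ratio_splits_imp_dual_family[OF D pruefer_imp_ratio_splits[OF P], of I "degree p" "coeff p"])
       (use p coeff_polys_over[OF p(1)] in \<open>auto simp: K I_def\<close>)
  define s where "s j = poly (poly_shift j p) t" for j
  have scaled: "Polynomial.smult (q i) p \<in> polys_over D" if "i \<in> I" for i
  proof -
    have "q i * coeff p j \<in> D" for j
      using q(1)[OF that, of j] subring_0[OF D]
      by (cases "j \<le> degree p") (auto simp: I_def coeff_eq_0)
    then show ?thesis by (simp add: polys_over_def)
  qed
  have "poly_shift j (Polynomial.smult c p) = Polynomial.smult c (poly_shift j p)" for c j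
    by (rule poly_eqI) (simp add: coeff_poly_shift)
  then have s_int: "q i * s j \<in> ?O" if "i \<in> I" for i j
    using integral_poly_shift[OF D scaled[OF that], of t j] p(3) by (simp add: s_def)
  have horner: "s j = coeff p j + t * s (Suc j)" for j
  proof -
    have "poly_shift j p = pCons (coeff p j) (poly_shift (Suc j) p)"
      by (rule poly_eqI) (simp add: coeff_poly_shift coeff_pCons split: nat.split)
    then show ?thesis by (simp add: s_def)
  qed
  have ts_int: "q i * (t * s j) \<in> ?O" if i: "i \<in> I" for i j
  proof (cases j)
    case 0
    then show ?thesis using p(3) subring_0[OF O] by (simp add: s_def)
  next
    case (Suc k)
    have "q i * coeff p k \<in> ?O"
      using coeff_polys_over[OF scaled[OF i], of k] subset_integral_closure[OF D] by auto
    moreover have "q i * (t * s j) = q i * s k - q i * coeff p k"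
      by (simp add: Suc horner[of k] algebra_simps)
    ultimately show ?thesis using s_int[OF i] subring_diff[OF O] by auto
  qed
  define g where "g = (\<Sum>i\<in>I. Polynomial.smult (q i) (poly_shift i p))"
  have g_t: "poly g t = (\<Sum>i\<in>I. q i * s i)" by (simp add: g_def poly_sum s_def)
  have "1 = (\<Sum>i\<in>I. q i * (s i - t * s (Suc i)))"
    using q(2) horner by (metis (no_types, lifting) add_diff_cancel_right' sum.cong)
  also have "\<dots> = poly g t - t * (\<Sum>i\<in>I. q i * s (Suc i))"
    by (simp add: g_t sum_subtractf right_diff_distrib sum_distrib_left mult_ac)
  finally have split: "1 - poly g t = - (\<Sum>i\<in>I. q i * s (Suc i)) * t" by (simp add: algebra_simps)
  show ?thesis
  proof (rule that)
    have "q i * lead_coeff p \<in> K" if "i \<in> I" for i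
      using q(1)[OF that, of "degree p"] subset_quotient_field[OF D] by (auto simp: K I_def)
    moreover have "inverse (lead_coeff p) \<in> K"
      unfolding K by (rule quotient_field_inverse[OF D]) (use p K in \<open>auto simp: coeff_polys_over\<close>)
    ultimately have "q i * lead_coeff p * inverse (lead_coeff p) \<in> K" if "i \<in> I" for i
      using that subring_mult[OF KK] by blast
    then have "q i \<in> K" if "i \<in> I" for i using that p(2) by (simp add: mult.assoc)
    moreover have "poly_shift i p \<in> polys_over K" for i
      using p(1) by (simp add: polys_over_def coeff_poly_shift)
    ultimately show "g \<in> polys_over K"
      unfolding g_def by (intro subring_sum[OF polys_over_subring[OF KK]] smult_polys_over[OF KK])
    show "poly g t \<in> ?O" unfolding g_t by (intro subring_sum[OF O] s_int)
    have "poly g t * t = (\<Sum>i\<in>I. q i * (t * s i))"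
      by (simp add: g_t sum_distrib_left sum_distrib_right mult_ac)
    then show "poly g t * t \<in> ?O" using subring_sum[OF O ts_int] by simp
    show "(1 - poly g t) / t \<in> ?O"
      unfolding split
      by (cases "t = 0") (auto intro!: subring_closed[OF O] subring_sum[OF O] s_int)
  qed
qed

section \<open>Polynomials over a subfield\<close>

locale subfield =
  fixes K :: "'a::field set"
  assumes subring: "is_subring K" and inverse: "x \<in> K \<Longrightarrow> inverse x \<in> K"
begin

lemma divide: "x \<in> K \<Longrightarrow> y \<in> K \<Longrightarrow> x / y \<in> K"
  by (simp add: divide_inverse inverse subring_mult[OF subring])

lemmas KX = polys_over_subring[OF subring]

text \<open>
  An element of least degree generates, since each step of the division by it has a quotient
  of leading coefficients from \<open>K\<close> as its coefficient.
\<close>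

lemma principal_ideal:
  assumes I: "I \<subseteq> polys_over K" "I \<noteq> {}"
    and closed: "\<And>a b c. a \<in> I \<Longrightarrow> b \<in> I \<Longrightarrow> c \<in> polys_over K \<Longrightarrow> a - c * b \<in> I"
  obtains h where "h \<in> I" "\<And>a. a \<in> I \<Longrightarrow> \<exists>c\<in>polys_over K. a = c * h"
proof (cases "I \<subseteq> {0}")
  case True
  with I have "I = {0}" by blast
  then show ?thesis using subring_0[OF KX] by (intro that[of 0]) auto
next
  case False
  then obtain k where "k \<in> I \<and> k \<noteq> 0" by blast
  from ex_has_least_nat[of "\<lambda>a. a \<in> I \<and> a \<noteq> 0", OF this, of degree]
  obtain h where h: "h \<in> I" "h \<noteq> 0" "\<And>a. a \<in> I \<Longrightarrow> a \<noteq> 0 \<Longrightarrow> degree h \<le> degree a"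
    by blast
  have "\<exists>c\<in>polys_over K. a = c * h" if "a \<in> I" for a
    using that
  proof (induction "degree a" arbitrary: a rule: less_induct)
    case less
    show ?case
    proof (cases "a = 0")
      case True
      then show ?thesis using subring_0[OF KX] by force
    next
      case a: False
      define m where "m = monom (lead_coeff a / lead_coeff h) (degree a - degree h)"
      have m: "m \<in> polys_over K"
        unfolding m_def using less.prems h(1) I(1)
        by (intro monom_polys_over[OF subring] divide coeff_polys_over subsetD[OF I(1)])
      have le: "degree h \<le> degree a" using h(3) less.prems a by blast
      let ?b = "a - m * h"
      have b: "?b \<in> I" using closed less.prems h(1) m by blast
      have deg_m: "degree (m * h) = degree a"
        using le a h(2) by (simp add: m_def degree_mult_eq degree_monom_eq)
      have "coeff (m * h) (degree a) = lead_coeff a"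
        using le h(2) by (simp add: m_def coeff_monom_mult)
      then have "coeff ?b (degree a) = 0" by simp
      moreover have "degree ?b \<le> degree a" using deg_m by (simp add: degree_diff_le)
      ultimately have "?b = 0 \<or> degree ?b < degree a"
        by (metis le_neq_implies_less leading_coeff_0_iff)
      then have "\<exists>c\<in>polys_over K. ?b = c * h"
      proof
        assume "?b = 0"
        then show ?thesis using subring_0[OF KX] by (intro bexI[of _ 0]) simp_all
      qed (rule less.hyps[OF _ b])
      then obtain c where c: "c \<in> polys_over K" "?b = c * h" by blast
      then have "a = (c + m) * h" by (simp add: algebra_simps)
      with c(1) show ?thesis using subring_add[OF KX] m by blast
    qed
  qed
  with h(1) that show ?thesis by blast
qed

lemma bezout:
  assumes f: "f \<in> polys_over K" and g: "g \<in> polys_over K" and "f \<noteq> 0"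
  obtains h f' g' A B where "h \<noteq> 0" "f = f' * h" "g = g' * h" "f' * A + g' * B = 1"
    "f' \<in> polys_over K" "g' \<in> polys_over K" "A \<in> polys_over K" "B \<in> polys_over K"
proof -
  let ?I = "{f * A + g * B |A B. A \<in> polys_over K \<and> B \<in> polys_over K}"
  have memI: "f * A + g * B \<in> ?I" if "A \<in> polys_over K" "B \<in> polys_over K" for A B
    using that by blast
  have "?I \<subseteq> polys_over K" using f g by (auto intro!: subring_closed[OF KX])
  moreover have "?I \<noteq> {}" using memI[OF subring_0[OF KX] subring_0[OF KX]] by blast
  moreover have "a - c * b \<in> ?I" if I: "a \<in> ?I" "b \<in> ?I" and c: "c \<in> polys_over K" for a b c
  proof -
    obtain A B A' B' where ab: "a = f * A + g * B" "b = f * A' + g * B'"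
      and AB: "A \<in> polys_over K" "B \<in> polys_over K" "A' \<in> polys_over K" "B' \<in> polys_over K"
      using I by blast
    have "a - c * b = f * (A - c * A') + g * (B - c * B')" by (simp add: ab algebra_simps)
    also have "\<dots> \<in> ?I" by (intro memI subring_closed[OF KX] AB c)
    finally show ?thesis .
  qed
  ultimately obtain h where h: "h \<in> ?I" "\<And>a. a \<in> ?I \<Longrightarrow> \<exists>c\<in>polys_over K. a = c * h"
    by (rule principal_ideal) auto
  obtain A B where AB: "A \<in> polys_over K" "B \<in> polys_over K" "h = f * A + g * B"
    using h(1) by blast
  obtain f' where f': "f' \<in> polys_over K" "f = f' * h"
    using h(2)[OF memI[OF subring_1[OF KX] subring_0[OF KX]]] by auto
  obtain g' where g': "g' \<in> polys_over K" "g = g' * h"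
    using h(2)[OF memI[OF subring_0[OF KX] subring_1[OF KX]]] by auto
  have h0: "h \<noteq> 0" using f' \<open>f \<noteq> 0\<close> by auto
  have "(f' * A + g' * B) * h = 1 * h"
    using AB(3) f'(2) g'(2) by (simp add: algebra_simps)
  then have "f' * A + g' * B = 1" using mult_right_cancel[OF h0] by blast
  with h0 f' g' AB that show ?thesis by blast
qed

text \<open>
  An algebraic equation for \<open>b \<noteq> 0\<close> may be divided by \<open>X\<close> until its constant term \<open>a\<close> is nonzero,
  and \<open>a + b p(b) = 0\<close> then shows that \<open>- p(b) / a\<close> is the inverse of \<open>b\<close>.
\<close>

lemma inverse_by_polynomial:
  assumes "algebraic_over K b" and b: "b \<noteq> 0"
  obtains Q where "Q \<in> polys_over K" "poly Q b * b = 1"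
proof -
  obtain p where "p \<in> polys_over K" "p \<noteq> 0" "poly p b = 0"
    using assms by (auto simp: algebraic_over_def)
  then have "\<exists>Q\<in>polys_over K. poly Q b * b = 1"
  proof (induction p)
    case 0
    then show ?case by simp
  next
    case (pCons a p)
    show ?case
    proof (cases "a = 0")
      case True
      then show ?thesis using pCons b by (auto simp: pCons_polys_over_iff)
    next
      case False
      have "a \<in> K" "p \<in> polys_over K" "a = - (b * poly p b)"
        using pCons.prems by (auto simp: pCons_polys_over_iff eq_neg_iff_add_eq_0)
      moreover from this False have "poly (Polynomial.smult (- inverse a) p) b * b = 1"
        by (simp add: field_simps)
      ultimately show ?thesis
        by (intro bexI[of _ "Polynomial.smult (- inverse a) p"] smult_polys_over subring_uminus
              subring inverse)
    qed
  qed
  with that show ?thesis by blast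
qed

end

lemma subfield_quotient_field: "is_subring D \<Longrightarrow> subfield (quotient_field D)"
  by unfold_locales (simp_all add: quotient_field_subring quotient_field_inverse)

text \<open>
  The hypothesis says that \<open>r\<close> is a root of the minimal polynomial of \<open>w\<close> over \<open>K\<close>. Integrality
  passes to conjugates because composing \<open>k\<close> with an equation over \<open>D\<close> for \<open>k(w)\<close>
  gives a polynomial over \<open>K\<close> that vanishes at \<open>w\<close>.
\<close>

lemma (in subfield) integral_at_conjugate:
  assumes conj: "\<And>q. q \<in> polys_over K \<Longrightarrow> poly q w = 0 \<Longrightarrow> poly q r = 0"
    and D: "D \<subseteq> K" and k: "k \<in> polys_over K" and int: "poly k w \<in> integral_closure D"
  shows "poly k r \<in> integral_closure D"
proof -
  obtain p where p: "p \<in> polys_over D" "lead_coeff p = 1" "poly p (poly k w) = 0"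
    using int by (rule integral_closureE)
  have "pcompose p k \<in> polys_over K"
    using polys_over_mono[OF D] p(1) by (intro pcompose_polys_over[OF subring _ k]) blast
  from conj[OF this] p show ?thesis
    by (intro integral_closureI[of p]) (auto simp: poly_pcompose)
qed

section \<open>Descent from the integral closure to an integrally closed domain\<close>

text \<open>
  One factor \<open>1 - r\<close> divisible by \<open>t\<close> makes the product \<open>y\<close> divisible by \<open>t\<close>, while \<open>1 - y\<close> lies in the
  ideal spanned by the \<open>r\<close>, all of which \<open>t\<close> multiplies into \<open>A\<close>.
\<close>

lemma prod_mset_splits_ratio:
  fixes t :: "'a::field"
  assumes A: "is_subring A"
    and "\<And>r. r \<in># M \<Longrightarrow> r \<in> A \<and> r * t \<in> A \<and> (1 - r) / t \<in> A"
  defines "y \<equiv> \<Prod>r\<in>#M. 1 - r"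
  shows "y \<in> A \<and> (1 - y) * t \<in> A \<and> (M \<noteq> {#} \<longrightarrow> y / t \<in> A)"
  using assms(2) unfolding y_def
proof (induction M)
  case empty
  then show ?case by (simp add: A subring_closed)
next
  case (add r M)
  define y where "y = (\<Prod>r\<in>#M. 1 - r)"
  have y: "y \<in> A" "(1 - y) * t \<in> A" using add by (auto simp: y_def)
  have r: "r \<in> A" "r * t \<in> A" "(1 - r) / t \<in> A" using add.prems by auto
  have "(1 - r) * y \<in> A" by (intro subring_closed[OF A] y r)
  moreover have "(1 - y) * t + (r * t) * y \<in> A" by (intro subring_closed[OF A] y r)
  then have "(1 - (1 - r) * y) * t \<in> A" by (simp add: algebra_simps)
  moreover have "((1 - r) / t) * y \<in> A" by (intro subring_closed[OF A] y r)
  ultimately show ?case by (simp flip: y_def)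
qed

text \<open>
  A splitting element \<open>u\<close> of \<open>t\<close> in the integral closure need not lie in \<open>K\<close>. If \<open>r\<close> runs
  through the roots of its minimal polynomial \<open>h\<close>, then \<open>1 - \<Prod>(1 - r)\<close> is a splitting
  element again, and it lies in \<open>K\<close> because the product is \<open>h(1)\<close> up to the leading coefficient.
\<close>

lemma ratio_splits_descends:
  fixes D :: "'a::alg_closed_field set"
  assumes D: "is_subring D" "integrally_closed D" and t: "t \<in> quotient_field D"
    and u: "u \<in> integral_closure D" "u * t \<in> integral_closure D" "(1 - u) / t \<in> integral_closure D"
  shows "ratio_splits D t"
proof -
  define K where "K = quotient_field D"
  interpret subfield K unfolding K_def by (rule subfield_quotient_field[OF D(1)])
  let ?O = "integral_closure D"
  have DK: "D \<subseteq> K" unfolding K_def by (rule subset_quotient_field[OF D(1)])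
  have descend: "x \<in> D" if "x \<in> K" "x \<in> ?O" for x
    using D(2) that by (auto simp: integrally_closed_def K_def integral_closure_def)
  have tK: "t \<in> K" using t by (simp add: K_def)
  define I where "I = {q \<in> polys_over K. poly q u = 0}"
  have "I \<subseteq> polys_over K" "I \<noteq> {}"
    using subring_0[OF KX] by (auto simp: I_def)
  moreover have "a - c * b \<in> I" if "a \<in> I" "b \<in> I" "c \<in> polys_over K" for a b c
    using that by (auto simp: I_def intro!: subring_closed[OF KX])
  ultimately obtain h where h: "h \<in> I" "\<And>a. a \<in> I \<Longrightarrow> \<exists>c\<in>polys_over K. a = c * h"
    by (rule principal_ideal) auto
  obtain p where p: "p \<in> polys_over D" "lead_coeff p = 1" "poly p u = 0"
    using u(1) by (rule integral_closureE)
  have "p \<in> I" using p polys_over_mono[OF DK] by (auto simp: I_def)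
  moreover have "p \<noteq> 0" using p(2) by auto
  ultimately have h0: "h \<noteq> 0" using h(2)[of p] by auto
  obtain M where M: "size M = degree h" "h = Polynomial.smult (lead_coeff h) (\<Prod>x\<in>#M. [:-x, 1:])"
    using alg_closed_imp_factorization[OF h0] by blast
  have hK: "h \<in> polys_over K" and hu: "poly h u = 0" using h(1) by (auto simp: I_def)
  have eval: "poly h z = lead_coeff h * (\<Prod>x\<in>#M. z - x)" for z
    by (subst M(2)) (simp add: poly_prod_mset image_mset.compositionality o_def)
  define y where "y = (\<Prod>x\<in>#M. 1 - x)"
  have "r \<in> ?O \<and> r * t \<in> ?O \<and> (1 - r) / t \<in> ?O" if r: "r \<in># M" for r
  proof -
    have "poly h r = 0" using r by (auto simp: eval prod_mset_zero_iff)
    then have conj: "poly q r = 0" if "q \<in> polys_over K" "poly q u = 0" for q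
      using h(2)[of q] that by (auto simp: I_def)
    have int: "poly k r \<in> ?O" if "k \<in> polys_over K" "poly k u \<in> ?O" for k
      by (rule integral_at_conjugate[OF _ DK that]) (rule conj)
    have zero: "0 \<in> K" and one: "1 \<in> K" using subring subring_closed by blast+
    have "[:0, 1:] \<in> polys_over K" "[:0, t:] \<in> polys_over K" "[:1 / t, - 1 / t:] \<in> polys_over K"
      using tK zero one subring
      by (auto simp: pCons_polys_over_iff subring_0[OF KX] intro!: divide subring_uminus)
    from this[THEN int] u show ?thesis by (simp add: diff_divide_distrib mult.commute)
  qed
  from prod_mset_splits_ratio[OF integral_closure_subring[OF D(1)] this]
  have y: "y \<in> ?O" "(1 - y) * t \<in> ?O" "M \<noteq> {#} \<longrightarrow> y / t \<in> ?O"
    unfolding y_def by blast+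
  have "M \<noteq> {#}" using eval[of u] hu h0 by auto
  with y have yt: "y / t \<in> ?O" by blast
  have "y = poly h 1 / lead_coeff h" using eval[of 1] h0 by (simp add: y_def)
  then have yK: "y \<in> K"
    using hK subring by (auto intro!: divide poly_in_subring coeff_polys_over subring_1)
  show ?thesis
    unfolding ratio_splits_def
  proof (intro bexI[of _ "1 - y"] conjI)
    show "(1 - y) * t \<in> D"
      by (intro descend y subring_closed[OF subring] yK tK)
    show "(1 - (1 - y)) / t \<in> D"
      using descend[OF divide[OF yK tK] yt] by simp
    show "1 - y \<in> D"
      by (intro descend subring_closed[OF subring] yK
            subring_closed[OF integral_closure_subring[OF D(1)]] y)
  qed
qed

section \<open>Bezout relations with integral products\<close>

text \<open>
  If moreover \<open>f z + g y = 1\<close> as polynomials and the relation holds at all \<open>w \<in> \<Omega>\<close>, then \<open>x = g y\<close> splits the ratio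
  \<open>t = f / g\<close> over the integer-valued polynomials, as \<open>x t = f y\<close> and \<open>(1 - x) / t = g z\<close>.
\<close>

definition integral_bezout ::
    "'a::field set \<Rightarrow> 'a poly \<Rightarrow> 'a poly \<Rightarrow> 'a poly \<Rightarrow> 'a poly \<Rightarrow> 'a \<Rightarrow> bool" where
  "integral_bezout B f g y z w \<longleftrightarrow> poly (f * z + g * y) w = 1 \<and>
     poly (f * y) w \<in> B \<and> poly (f * z) w \<in> B \<and> poly (g * y) w \<in> B \<and> poly (g * z) w \<in> B"

lemma integral_bezout_cong:
  "poly y w = poly y' w \<Longrightarrow> poly z w = poly z' w \<Longrightarrow>
     integral_bezout B f g y z w \<longleftrightarrow> integral_bezout B f g y' z' w"
  by (simp add: integral_bezout_def)

context
  fixes D K :: "'a::field set"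
  assumes P: "pruefer_domain D" and K: "K = quotient_field D"
    and algebraic: "\<And>x. algebraic_over K x"
begin

lemma subring_D: "is_subring D"
  using P by (simp add: pruefer_domain_def)

interpretation subfield K
  unfolding K by (rule subfield_quotient_field[OF subring_D])

text \<open>
  Where both values \<open>a = f(w)\<close> and \<open>b = g(w)\<close> are nonzero, a splitting element \<open>x\<close> of \<open>a / b\<close> calls
  for the values \<open>x / b\<close> of \<open>y\<close> and \<open>(1 - x) / a\<close> of \<open>z\<close>. They are values at \<open>w\<close> of polynomials over \<open>K\<close>
  because \<open>x \<in> K[a / b]\<close> and \<open>K[w]\<close> is a field. Where one value vanishes, the given Bezout
  coefficient of the other one is its inverse.
\<close>

lemma integral_bezout_at_point:
  assumes f: "f \<in> polys_over K" and g: "g \<in> polys_over K"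
    and AB: "A \<in> polys_over K" "B \<in> polys_over K" "f * A + g * B = 1"
  shows "\<exists>y\<in>polys_over K. \<exists>z\<in>polys_over K. integral_bezout (integral_closure D) f g y z w"
proof -
  let ?O = "integral_closure D"
  note O = integral_closure_subring[OF subring_D]
  have ab: "poly f w * poly A w + poly g w * poly B w = 1"
    using arg_cong[OF AB(3), of "\<lambda>p. poly p w"] by simp
  consider "poly g w = 0" | "poly f w = 0" | "poly f w \<noteq> 0" "poly g w \<noteq> 0" by blast
  then show ?thesis
  proof cases
    case 1
    with ab have "integral_bezout ?O f g 0 A w"
      by (simp add: integral_bezout_def subring_closed[OF O])
    then show ?thesis using AB subring_0[OF KX] by blast
  next
    case 2
    with ab have "integral_bezout ?O f g B 0 w"
      by (simp add: integral_bezout_def subring_closed[OF O])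
    then show ?thesis using AB subring_0[OF KX] by blast
  next
    case 3
    define a b where "a = poly f w" and "b = poly g w"
    have nz: "a \<noteq> 0" "b \<noteq> 0" using 3 by (auto simp: a_def b_def)
    obtain Qa where Qa: "Qa \<in> polys_over K" "poly Qa a * a = 1"
      using inverse_by_polynomial[OF algebraic nz(1)] by blast
    obtain Qb where Qb: "Qb \<in> polys_over K" "poly Qb b * b = 1"
      using inverse_by_polynomial[OF algebraic nz(2)] by blast
    obtain G where G: "G \<in> polys_over K" "poly G (a / b) \<in> ?O" "poly G (a / b) * (a / b) \<in> ?O"
      "(1 - poly G (a / b)) / (a / b) \<in> ?O"
      using ratio_splits_integral_closure[OF P K algebraic] by blast
    define inv_f inv_g where "inv_f = pcompose Qa f" and "inv_g = pcompose Qb g"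
    define x where "x = pcompose G (f * inv_g)"
    have inv_K: "inv_f \<in> polys_over K" "inv_g \<in> polys_over K"
      unfolding inv_f_def inv_g_def by (intro pcompose_polys_over subring Qa Qb f g)+
    have x_K: "x \<in> polys_over K"
      unfolding x_def by (intro pcompose_polys_over subring G subring_mult[OF KX] f inv_K)
    have inv_w: "poly inv_f w = 1 / a" "poly inv_g w = 1 / b"
      using Qa(2) Qb(2) nz by (simp_all add: inv_f_def inv_g_def poly_pcompose field_simps flip: a_def b_def)
    then have x_w: "poly x w = poly G (a / b)" by (simp add: x_def poly_pcompose a_def)
    have "1 - poly x w \<in> ?O" using G(2) by (auto simp: x_w intro!: subring_closed[OF O])
    then have "integral_bezout ?O f g (x * inv_g) ((1 - x) * inv_f) w"
      using G nz by (simp add: integral_bezout_def inv_w x_w field_simps flip: a_def b_def)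
    moreover have "x * inv_g \<in> polys_over K" "(1 - x) * inv_f \<in> polys_over K"
      by (intro subring_closed[OF KX] x_K inv_K)+
    ultimately show ?thesis by blast
  qed
qed

text \<open>
  A new point conjugate to an old one inherits the relation. Otherwise some polynomial over \<open>K\<close>
  vanishes at the old points and not at the new one; a multiple of it takes the value \<open>1\<close> there and
  interpolates between the old solution and one at the new point.
\<close>

lemma integral_bezout_at_finitely_many:
  assumes "finite \<Omega>" and f: "f \<in> polys_over K" and g: "g \<in> polys_over K"
    and AB: "A \<in> polys_over K" "B \<in> polys_over K" "f * A + g * B = 1"
  shows "\<exists>y\<in>polys_over K. \<exists>z\<in>polys_over K.
           \<forall>w\<in>\<Omega>. integral_bezout (integral_closure D) f g y z w"
  using assms(1)
proof (induction \<Omega>)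
  case empty
  then show ?case using subring_0[OF KX] by blast
next
  case (insert w F)
  let ?bez = "integral_bezout (integral_closure D) f g"
  obtain y z where yz: "y \<in> polys_over K" "z \<in> polys_over K" "\<And>v. v \<in> F \<Longrightarrow> ?bez y z v"
    using insert.IH by blast
  show ?case
  proof (cases "\<exists>v\<in>F. \<forall>q\<in>polys_over K. poly q v = 0 \<longrightarrow> poly q w = 0")
    case True
    then obtain v where v: "v \<in> F"
      and conj: "\<And>q. q \<in> polys_over K \<Longrightarrow> poly q v = 0 \<Longrightarrow> poly q w = 0" by blast
    have int: "poly k w \<in> integral_closure D"
      if "k \<in> polys_over K" "poly k v \<in> integral_closure D" for k
      by (rule integral_at_conjugate[OF _ subset_quotient_field[OF subring_D, folded K] that]) (rule conj)
    have bez: "?bez y z v" by (rule yz(3)[OF v])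
    have "poly (f * z + g * y - 1) w = 0"
      using bez by (intro conj subring_closed[OF KX] f g yz) (simp add: integral_bezout_def)
    moreover have "poly (f * y) w \<in> integral_closure D" "poly (f * z) w \<in> integral_closure D"
      "poly (g * y) w \<in> integral_closure D" "poly (g * z) w \<in> integral_closure D"
      using bez unfolding integral_bezout_def
      by (intro int subring_mult[OF KX] f g yz; blast)+
    ultimately have "?bez y z w" by (simp add: integral_bezout_def)
    with yz show ?thesis by blast
  next
    case False
    then have "\<forall>v\<in>F. \<exists>q. q \<in> polys_over K \<and> poly q v = 0 \<and> poly q w \<noteq> 0" by blast
    then obtain q where q: "\<And>v. v \<in> F \<Longrightarrow> q v \<in> polys_over K \<and> poly (q v) v = 0 \<and> poly (q v) w \<noteq> 0"
      by metis
    define N where "N = (\<Prod>v\<in>F. q v)"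
    have N: "N \<in> polys_over K" "\<And>v. v \<in> F \<Longrightarrow> poly N v = 0" "poly N w \<noteq> 0"
      using q insert.hyps by (auto simp: N_def poly_prod prod_zero_iff intro!: subring_prod[OF KX])
    obtain Q where Q: "Q \<in> polys_over K" "poly Q (poly N w) * poly N w = 1"
      using inverse_by_polynomial[OF algebraic N(3)] by blast
    define e where "e = pcompose Q N * N"
    have e: "e \<in> polys_over K" "\<And>v. v \<in> F \<Longrightarrow> poly e v = 0" "poly e w = 1"
      using Q(2) N by (auto simp: e_def poly_pcompose intro!: subring_mult[OF KX] pcompose_polys_over subring Q)
    obtain y' z' where yz': "y' \<in> polys_over K" "z' \<in> polys_over K" "?bez y' z' w"
      using integral_bezout_at_point[OF f g AB] by blast
    define Y Z where "Y = y * (1 - e) + y' * e" and "Z = z * (1 - e) + z' * e"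
    have "?bez Y Z v" if "v \<in> F" for v
      using yz(3)[OF that] e(2)[OF that] integral_bezout_cong[of Y v y Z z]
      by (simp add: Y_def Z_def)
    moreover have "?bez Y Z w"
      using yz'(3) e(3) integral_bezout_cong[of Y w y' Z z'] by (simp add: Y_def Z_def)
    moreover have "Y \<in> polys_over K" "Z \<in> polys_over K"
      unfolding Y_def Z_def by (intro subring_closed[OF KX] yz yz' e)+
    ultimately show ?thesis by blast
  qed
qed

text \<open>
  The error \<open>k\<close> of the relation vanishes on \<open>\<Omega>\<close>, so adding multiples of it to the solution
  changes no value there and a Bezout relation in \<open>K[X]\<close> absorbs it.
\<close>

lemma global_integral_bezout:
  assumes "finite \<Omega>" and f: "f \<in> polys_over K" and g: "g \<in> polys_over K"
    and AB: "A \<in> polys_over K" "B \<in> polys_over K" "f * A + g * B = 1"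
  obtains y z where "y \<in> polys_over K" "z \<in> polys_over K" "f * z + g * y = 1"
    "\<And>w. w \<in> \<Omega> \<Longrightarrow> integral_bezout (integral_closure D) f g y z w"
proof -
  obtain y z where yz: "y \<in> polys_over K" "z \<in> polys_over K"
    "\<And>w. w \<in> \<Omega> \<Longrightarrow> integral_bezout (integral_closure D) f g y z w"
    using integral_bezout_at_finitely_many[OF assms] by blast
  define k where "k = 1 - (f * z + g * y)"
  have k: "k \<in> polys_over K" unfolding k_def by (intro subring_closed[OF KX] f g yz)
  have k0: "poly k w = 0" if "w \<in> \<Omega>" for w
    using yz(3)[OF that] by (simp add: k_def integral_bezout_def)
  show ?thesis
  proof (rule that)
    show "y + k * B \<in> polys_over K" "z + k * A \<in> polys_over K"
      by (intro subring_closed[OF KX] yz k AB)+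
    have "f * (z + k * A) + g * (y + k * B) = f * z + g * y + k * (f * A + g * B)"
      by (simp add: algebra_simps)
    then show "f * (z + k * A) + g * (y + k * B) = 1" by (simp add: AB(3) k_def)
  next
    fix w assume w: "w \<in> \<Omega>"
    show "integral_bezout (integral_closure D) f g (y + k * B) (z + k * A) w"
      using yz(3)[OF w] integral_bezout_cong[of "y + k * B" w y "z + k * A" z] k0[OF w] by simp
  qed
qed

end

section \<open>Integer-valued polynomials\<close>

lemma int_valued_subring:
  assumes "is_subring K" "is_subring B"
  shows "is_subring (int_valued K \<Omega> B)"
  using subring_closed[OF polys_over_subring[OF assms(1)]] subring_closed[OF assms(2)]
  by (auto simp: is_subring_def int_valued_def image_subset_iff)

lemma to_fract_image_subring:
  assumes "is_subring R" shows "is_subring (to_fract ` R)"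
  unfolding is_subring_def
proof (intro conjI ballI)
  show "1 \<in> to_fract ` R" using subring_1[OF assms] by (metis image_eqI to_fract_1)
next
  fix x y assume "x \<in> to_fract ` R" "y \<in> to_fract ` R"
  then obtain a b where "x = to_fract a" "y = to_fract b" "a \<in> R" "b \<in> R" by blast
  then show "x - y \<in> to_fract ` R" "x * y \<in> to_fract ` R"
    using subring_diff[OF assms] subring_mult[OF assms] by (metis image_eqI to_fract_diff to_fract_mult)+
qed

theorem theorem1p4:
  fixes D K \<Omega> :: "'l::alg_closed_field set"
  assumes domain_D: "is_subring D"
    and not_field: "\<not> (\<forall>x\<in>D. x \<noteq> 0 \<longrightarrow> inverse x \<in> D)"
    and K_def: "K = quotient_field D"
    and algebraic_closure: "\<forall>x::'l. algebraic_over K x"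
    and D_closed: "integrally_closed D"
    and \<Omega>_finite: "finite \<Omega>"
    and \<Omega>_nonempty: "\<Omega> \<noteq> {}"
    and \<Omega>_subset: "\<Omega> \<subseteq> integral_closure D"
  shows "pruefer_domain (to_fract ` int_valued K \<Omega> (integral_closure D)) \<longleftrightarrow> pruefer_domain D"
proof -
  let ?O = "integral_closure D" and ?R = "int_valued K \<Omega> (integral_closure D)"
  interpret subfield K unfolding K_def by (rule subfield_quotient_field[OF domain_D])
  note O = integral_closure_subring[OF domain_D]
  have R: "is_subring ?R" by (rule int_valued_subring[OF subring O])
  note RX = to_fract_image_subring[OF R]
  have const: "[:d:] \<in> ?R" if "d \<in> D" for d
    using that subset_quotient_field[OF domain_D] subset_integral_closure[OF domain_D]
    by (auto simp: int_valued_def K_def polys_over_const[OF quotient_field_subring[OF domain_D]])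
  show ?thesis
  proof
    (* A ratio of constants splits over the polynomials; the value of the splitting element at a
       point of \<Omega> splits it over the integral closure of D. *)
    assume P: "pruefer_domain (to_fract ` ?R)"
    obtain w where w: "w \<in> \<Omega>" using \<Omega>_nonempty by blast
    have "ratio_splits D t" if t: "t \<in> quotient_field D" for t
    proof -
      obtain a b where ab: "t = a / b" "a \<in> D" "b \<in> D" "b \<noteq> 0"
        using t by (auto simp: quotient_field_def)
      show ?thesis
      proof (cases "a = 0")
        case True
        then show ?thesis using ab by (simp add: ratio_splits_0[OF domain_D])
      next
        case False
        let ?a = "to_fract [:a:]" and ?b = "to_fract [:b:]"
        have nz: "?a \<noteq> 0" "?b \<noteq> 0" using ab False by simp_all
        have "ratio_splits (to_fract ` ?R) (?a / ?b)"
          by (intro pruefer_imp_ratio_splits[OF P] quotient_field_divide[OF RX] imageI const ab)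
        then obtain x h1 h2 where x: "x \<in> ?R" "h1 \<in> ?R" "h2 \<in> ?R"
          and h1: "to_fract x * (?a / ?b) = to_fract h1"
          and h2: "(1 - to_fract x) / (?a / ?b) = to_fract h2"
          unfolding ratio_splits_def by blast
        have "to_fract x * ?a = to_fract h1 * ?b"
          using h1 nz by (simp add: field_simps)
        then have "to_fract (x * [:a:]) = to_fract (h1 * [:b:])"
          by (simp only: to_fract_mult to_fract_diff to_fract_1)
        then have "x * [:a:] = h1 * [:b:]" by (simp only: to_fract_eq_iff)
        then have 1: "poly x w * a = poly h1 w * b"
          by (metis poly_mult poly_const_conv)
        have "(1 - to_fract x) * ?b = to_fract h2 * ?a"
          using h2 nz by (simp add: field_simps)
        then have "to_fract ((1 - x) * [:b:]) = to_fract (h2 * [:a:])"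
          by (simp only: to_fract_mult to_fract_diff to_fract_1)
        then have "(1 - x) * [:b:] = h2 * [:a:]" by (simp only: to_fract_eq_iff)
        then have 2: "(1 - poly x w) * b = poly h2 w * a"
          by (metis poly_mult poly_const_conv poly_diff poly_1)
        have O_w: "poly x w \<in> ?O" "poly h1 w \<in> ?O" "poly h2 w \<in> ?O"
          using x w by (auto simp: int_valued_def)
        have "poly x w * t = (poly x w * a) / b" "(1 - poly x w) / t = ((1 - poly x w) * b) / a"
          by (simp_all add: ab(1))
        then have "poly x w * t = poly h1 w" "(1 - poly x w) / t = poly h2 w"
          unfolding 1 2 using ab(4) False by simp_all
        with O_w show ?thesis using ratio_splits_descends[OF domain_D D_closed t] by metis
      qed
    qed
    then show "pruefer_domain D" by (rule ratio_splits_imp_pruefer[OF domain_D])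
  next
    (* A common factor of numerator and denominator does not affect the ratio, but dividing by it
       may leave the ring of integer-valued polynomials; only coprimality in K[X] matters below. *)
    assume P: "pruefer_domain D"
    have "ratio_splits (to_fract ` ?R) t" if t: "t \<in> quotient_field (to_fract ` ?R)" for t
    proof -
      obtain f g where fg: "t = to_fract f / to_fract g" "f \<in> ?R" "g \<in> ?R" "g \<noteq> 0"
        using t by (auto simp: quotient_field_def)
      show ?thesis
      proof (cases "f = 0")
        case True
        then show ?thesis using fg by (simp add: ratio_splits_0[OF RX])
      next
        case False
        have "f \<in> polys_over K" "g \<in> polys_over K" using fg by (auto simp: int_valued_def)
        from bezout[OF this False]
        obtain h f' g' A B where h: "h \<noteq> 0" "f = f' * h" "g = g' * h" and AB: "f' * A + g' * B = 1"
          and K: "f' \<in> polys_over K" "g' \<in> polys_over K" "A \<in> polys_over K" "B \<in> polys_over K"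
          by blast
        obtain y z where yz: "y \<in> polys_over K" "z \<in> polys_over K" "f' * z + g' * y = 1"
          "\<And>w. w \<in> \<Omega> \<Longrightarrow> integral_bezout ?O f' g' y z w"
          using global_integral_bezout[OF P K_def algebraic_closure[rule_format] \<Omega>_finite K AB] by blast
        have in_R: "f' * y \<in> ?R" "g' * y \<in> ?R" "g' * z \<in> ?R"
          using yz(4) by (auto simp: int_valued_def integral_bezout_def intro!: subring_mult[OF KX] K yz)
        have nz: "to_fract f' \<noteq> 0" "to_fract g' \<noteq> 0" "to_fract h \<noteq> 0"
          using h False fg(4) by auto
        have t': "t = to_fract f' / to_fract g'"
          using nz fg(1) h by simp
        have one_minus: "1 - to_fract (g' * y) = to_fract (f' * z)"
          by (metis add_diff_cancel_right' to_fract_1 to_fract_diff yz(3))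
        have "to_fract (g' * y) * t = to_fract (f' * y)"
          using nz by (simp add: t')
        moreover have "(1 - to_fract (g' * y)) / t = to_fract (g' * z)"
          unfolding one_minus t' using nz by simp
        ultimately show ?thesis
          using in_R unfolding ratio_splits_def by (intro bexI[of _ "to_fract (g' * y)"] conjI) (metis imageI)+
      qed
    qed
    then show "pruefer_domain (to_fract ` ?R)" by (rule ratio_splits_imp_pruefer[OF RX])
  qed
qed

end
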